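(* Let $\mathcal{C}=((J_0,U_0),\ldots,(J_\ell,U_\ell))$ be an idealistic chain in a distributive lattice $T$. (1) The chain $\mathcal{C}$ collapses if and only if there exist $x_1,\ldots,x_\ell\in T$ and a finite idealistic chain $\mathcal{C}'=((J'_0,U'_0),\ldots,(J'_\ell,U'_\ell))$ of which $\mathcal{C}$ is a refinement, with the following relations in $T$: $$\begin{array}{rcl} x_1,\;U'_0&\vdash&J'_0\\ x_2,\;U'_1&\vdash&J'_1,\;x_1\\ &\vdots&\\ x_\ell,\;U'_{\ell-1}&\vdash&J'_{\ell-1},\;x_{\ell-1}\\ U'_\ell&\vdash&J'_\ell,\;x_\ell \end{array}$$ (2) The chain $\mathcal{C}$ generates a minimum saturated idealistic chain (the least saturated idealistic chain refining $\mathcal{C}$). It is obtained by adding to $U_i$ (resp. $J_i$), for each $i$, each element $a\in T$ such that the idealistic chain $((J_0,U_0),\ldots,(J_i\cup\{a\},U_i),\ldots,(J_\ell,U_\ell))$ (resp. $((J_0,U_0),\ldots,(J_i,U_i\cup\{a\}),\ldots,(J_\ell,U_\ell))$) collapses. (3) Let $x\in T$ and let $i\in\{0,\ldots,\ell\}$. Suppose that the idealistic chains $((J_0,U_0),\ldots,(J_i\cup\{x\},U_i),\ldots,(J_\ell,U_\ell))$ and $((J_0,U_0),\ldots,(J_i,U_i\cup\{x\}),\ldots,(J_\ell,U_\ell))$ both collapse. Then $\mathcal{C}$ collapses.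
   Context: Distributive lattices have a minimum $0$ and a maximum $1$. For finite subsets $A,B$ of $T$, $A\vdash B$ means $\bigwedge A\le\bigvee B$; in such relations $x$ stands for $\{x\}$ and a comma stands for union. An idealistic chain of length $\ell$ in $T$ is a list $((J_0,U_0),\ldots,(J_\ell,U_\ell))$ of $\ell+1$ pairs of subsets of $T$; it is finite if all the $J_i,U_i$ are finite. $\mathcal{C}'=((J'_i,U'_i))_i$ is a refinement of $\mathcal{C}=((J_i,U_i))_i$ (of the same length) if $J_i\subseteq J'_i$ and $U_i\subseteq U'_i$ for all $i$. An ideal $I$ and a filter $F$ of $T$ are conjugate if ($f\in F$, $x\wedge f\in I$ imply $x\in I$) and ($j\in I$, $x\vee j\in F$ imply $x\in F$). The chain $((J_i,U_i))_i$ is saturated if every $J_i$ is an ideal, every $U_i$ is a filter, $J_i$ and $U_i$ are conjugate, and $J_i\subseteq J_{i+1}$, $U_{i+1}\subseteq U_i$ for $0\le i<\ell$. An idealistic chain $\mathcal{C}$ collapses if the only saturated idealistic chain refining $\mathcal{C}$ is the trivial chain $((T,T),\ldots,(T,T))$. *)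

theory Defs
  imports Main
begin

text \<open>
  A distributive lattice with minimum and maximum is a type of sort
  \<open>{bounded_lattice, distrib_lattice}\<close>; the trivial lattice (\<open>bot = top\<close>) is allowed.
\<close>

text \<open>
  Inserting \<open>top\<close> and \<open>bot\<close> gives the empty meet and the empty join their values.
  The relation is only meaningful for finite sets.
\<close>

definition entails :: "'a::{bounded_lattice,distrib_lattice} set \<Rightarrow> 'a set \<Rightarrow> bool"
    (infix "\<turnstile>" 50) where
  "A \<turnstile> B \<longleftrightarrow> Inf_fin (insert top A) \<le> Sup_fin (insert bot B)"

text \<open>Ideals and filters are not required to be proper.\<close>

definition lattice_ideal :: "'a::{bounded_lattice,distrib_lattice} set \<Rightarrow> bool" where
  "lattice_ideal I \<longleftrightarrow>
     bot \<in> I \<and>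
     (\<forall>x\<in>I. \<forall>y\<in>I. sup x y \<in> I) \<and>
     (\<forall>x\<in>I. \<forall>z. inf x z \<in> I)"

definition lattice_filter :: "'a::{bounded_lattice,distrib_lattice} set \<Rightarrow> bool" where
  "lattice_filter F \<longleftrightarrow>
     top \<in> F \<and>
     (\<forall>x\<in>F. \<forall>y\<in>F. inf x y \<in> F) \<and>
     (\<forall>x\<in>F. \<forall>z. sup x z \<in> F)"

definition conjugate :: "'a::{bounded_lattice,distrib_lattice} set \<Rightarrow> 'a set \<Rightarrow> bool" where
  "conjugate I F \<longleftrightarrow>
     (\<forall>x. \<forall>f\<in>F. inf x f \<in> I \<longrightarrow> x \<in> I) \<and>
     (\<forall>x. \<forall>j\<in>I. sup x j \<in> F \<longrightarrow> x \<in> F)"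

type_synonym 'a ichain = "('a set \<times> 'a set) list"

abbreviation chain_J :: "'a ichain \<Rightarrow> nat \<Rightarrow> 'a set" where
  "chain_J C i \<equiv> fst (C ! i)"

abbreviation chain_U :: "'a ichain \<Rightarrow> nat \<Rightarrow> 'a set" where
  "chain_U C i \<equiv> snd (C ! i)"

definition idealistic_chain :: "nat \<Rightarrow> 'a ichain \<Rightarrow> bool" where
  "idealistic_chain l C \<longleftrightarrow> length C = Suc l"

definition finite_chain :: "'a ichain \<Rightarrow> bool" where
  "finite_chain C \<longleftrightarrow> (\<forall>i<length C. finite (chain_J C i) \<and> finite (chain_U C i))"

text \<open>\<open>refinement C' C\<close>: the chain \<open>C'\<close> is a refinement of \<open>C\<close>.\<close>

definition refinement :: "'a ichain \<Rightarrow> 'a ichain \<Rightarrow> bool" where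
  "refinement C' C \<longleftrightarrow>
     length C' = length C \<and>
     (\<forall>i<length C. chain_J C i \<subseteq> chain_J C' i \<and> chain_U C i \<subseteq> chain_U C' i)"

definition saturated :: "'a::{bounded_lattice,distrib_lattice} ichain \<Rightarrow> bool" where
  "saturated C \<longleftrightarrow>
     (\<forall>i<length C. lattice_ideal (chain_J C i) \<and> lattice_filter (chain_U C i) \<and>
        conjugate (chain_J C i) (chain_U C i)) \<and>
     (\<forall>i. Suc i < length C \<longrightarrow>
        chain_J C i \<subseteq> chain_J C (Suc i) \<and> chain_U C (Suc i) \<subseteq> chain_U C i)"

definition collapses :: "'a::{bounded_lattice,distrib_lattice} ichain \<Rightarrow> bool" where
  "collapses C \<longleftrightarrow>
     {D. saturated D \<and> refinement D C} = {replicate (length C) (UNIV, UNIV)}"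

definition add_J :: "'a ichain \<Rightarrow> nat \<Rightarrow> 'a \<Rightarrow> 'a ichain" where
  "add_J C i a = C[i := (chain_J C i \<union> {a}, chain_U C i)]"

definition add_U :: "'a ichain \<Rightarrow> nat \<Rightarrow> 'a \<Rightarrow> 'a ichain" where
  "add_U C i a = C[i := (chain_J C i, chain_U C i \<union> {a})]"

definition least_saturated_refinement ::
    "'a::{bounded_lattice,distrib_lattice} ichain \<Rightarrow> 'a ichain \<Rightarrow> bool" where
  "least_saturated_refinement D C \<longleftrightarrow>
     saturated D \<and> refinement D C \<and>
     (\<forall>E. saturated E \<and> refinement E C \<longrightarrow> refinement E D)"

text \<open>
  Note the exchange of roles: \<open>J\<^sub>i\<close> receives the elements whose addition to \<open>U\<^sub>i\<close> makes the
  original chain collapse, and vice versa.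
\<close>

definition collapse_extension ::
    "'a::{bounded_lattice,distrib_lattice} ichain \<Rightarrow> 'a ichain" where
  "collapse_extension C =
     map (\<lambda>i. (chain_J C i \<union> {a. collapses (add_U C i a)},
               chain_U C i \<union> {a. collapses (add_J C i a)}))
       [0..<length C]"

end

theory Submission
  imports Defs
begin

text \<open>
  Write \<open>y \<le>\<^sub>i x\<close> if \<open>y \<le> x\<close> in the quotient of the lattice in which the elements of \<open>J\<^sub>i\<close> become
  \<open>bot\<close> and those of \<open>U\<^sub>i\<close> become \<open>top\<close>. With \<open>x\<^sub>0 = bot\<close> and \<open>x\<^bsub>l+1\<^esub> = top\<close> the relations of (1)
  say \<open>top \<le>\<^sub>l x\<^sub>l \<le> \<dots> \<le> x\<^sub>1 \<le>\<^sub>0 bot\<close>, and adding \<open>a\<close> to \<open>U\<^sub>i\<close> or \<open>J\<^sub>i\<close> only replaces the link at \<open>i\<close> by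
  \<open>a \<sqinter> x\<^bsub>i+1\<^esub> \<le>\<^sub>i x\<^sub>i\<close> or \<open>x\<^bsub>i+1\<^esub> \<le>\<^sub>i a \<squnion> x\<^sub>i\<close>. Two such sequences merge into one by taking meets above \<open>i\<close>
  and joins up to \<open>i\<close>; this yields the cut property (3) for the relations of (1), and the saturation
  of the chain described in (2) when collapse is replaced by these relations. A chain that
  collapses then satisfies them by a cut.
\<close>

text \<open>The sets \<open>J\<close> and \<open>U\<close> may be infinite; the finite witnesses
  \<open>A\<close> and \<open>B\<close> later supply the components of the finite chain.\<close>

definition quot_le :: "'a::{bounded_lattice,distrib_lattice} set \<Rightarrow> 'a set \<Rightarrow> 'a \<Rightarrow> 'a \<Rightarrow> bool" where
  "quot_le J U y x \<longleftrightarrow>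
     (\<exists>A B. finite A \<and> finite B \<and> A \<subseteq> U \<and> B \<subseteq> J \<and> insert y A \<turnstile> insert x B)"

definition link :: "'a::{bounded_lattice,distrib_lattice} ichain \<Rightarrow> nat \<Rightarrow> 'a \<Rightarrow> 'a \<Rightarrow> bool" where
  "link C i = quot_le (chain_J C i) (chain_U C i)"

text \<open>Leaving out the link at \<open>i\<close> isolates the only condition that changes when
  an element is added to \<open>J\<close> or \<open>U\<close> at index \<open>i\<close>.\<close>

definition linked_except ::
    "'a::{bounded_lattice,distrib_lattice} ichain \<Rightarrow> nat \<Rightarrow> (nat \<Rightarrow> 'a) \<Rightarrow> bool" where
  "linked_except C i x \<longleftrightarrow> x 0 = bot \<and> x (length C) = top \<and>
     (\<forall>k<length C. k \<noteq> i \<longrightarrow> link C k (x (Suc k)) (x k))"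

definition linkable :: "'a::{bounded_lattice,distrib_lattice} ichain \<Rightarrow> bool" where
  "linkable C \<longleftrightarrow> (\<exists>x. x 0 = bot \<and> x (length C) = top \<and>
     (\<forall>k<length C. link C k (x (Suc k)) (x k)))"

section \<open>The order of the quotient lattice\<close>

lemma Inf_fin_insert_top_insert:
  fixes A :: "'a::bounded_lattice set"
  assumes "finite A"
  shows "Inf_fin (insert top (insert a A)) = inf a (Inf_fin (insert top A))"
  by (subst insert_commute, rule Inf_fin.insert) (use assms in auto)

lemma Sup_fin_insert_bot_insert:
  fixes B :: "'a::bounded_lattice set"
  assumes "finite B"
  shows "Sup_fin (insert bot (insert b B)) = sup b (Sup_fin (insert bot B))"
  by (subst insert_commute, rule Sup_fin.insert) (use assms in auto)

lemma entails_insert: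
  assumes "finite A" "finite B"
  shows "insert y A \<turnstile> insert x B \<longleftrightarrow>
    inf y (Inf_fin (insert top A)) \<le> sup x (Sup_fin (insert bot B))"
  unfolding entails_def
  using assms by (simp only: Inf_fin_insert_top_insert Sup_fin_insert_bot_insert)

lemma entails_insert_bot: "finite B \<Longrightarrow> A \<turnstile> insert bot B \<longleftrightarrow> A \<turnstile> B"
  by (simp add: entails_def)

lemma entails_insert_top: "finite A \<Longrightarrow> insert top A \<turnstile> B \<longleftrightarrow> A \<turnstile> B"
  by (simp add: entails_def)

lemma quot_le_iff:
  "quot_le J U y x \<longleftrightarrow> (\<exists>A B. finite A \<and> finite B \<and> A \<subseteq> U \<and> B \<subseteq> J \<and>
     inf y (Inf_fin (insert top A)) \<le> sup x (Sup_fin (insert bot B)))"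
  unfolding quot_le_def by (simp add: entails_insert cong: conj_cong)

lemma Inf_fin_insert_top_Un:
  fixes A B :: "'a::bounded_lattice set"
  assumes "finite A" "finite B"
  shows "Inf_fin (insert top (A \<union> B)) = inf (Inf_fin (insert top A)) (Inf_fin (insert top B))"
  using Inf_fin.union[of "insert top A" "insert top B"] assms by simp

lemma Sup_fin_insert_bot_Un:
  fixes A B :: "'a::bounded_lattice set"
  assumes "finite A" "finite B"
  shows "Sup_fin (insert bot (A \<union> B)) = sup (Sup_fin (insert bot A)) (Sup_fin (insert bot B))"
  using Sup_fin.union[of "insert bot A" "insert bot B"] assms by simp

text \<open>Unions of the witnesses serve both inequalities: enlarging \<open>A\<close> lowers its
  meet and enlarging \<open>B\<close> raises its join.\<close>

lemma quot_le_common: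
  assumes "quot_le J U y x" "quot_le J U y' x'"
  obtains A B where "finite A" "finite B" "A \<subseteq> U" "B \<subseteq> J"
    "inf y (Inf_fin (insert top A)) \<le> sup x (Sup_fin (insert bot B))"
    "inf y' (Inf_fin (insert top A)) \<le> sup x' (Sup_fin (insert bot B))"
proof -
  obtain A B where 1: "finite A" "finite B" "A \<subseteq> U" "B \<subseteq> J"
    "inf y (Inf_fin (insert top A)) \<le> sup x (Sup_fin (insert bot B))"
    using assms(1) unfolding quot_le_iff by blast
  obtain A' B' where 2: "finite A'" "finite B'" "A' \<subseteq> U" "B' \<subseteq> J"
    "inf y' (Inf_fin (insert top A')) \<le> sup x' (Sup_fin (insert bot B'))"
    using assms(2) unfolding quot_le_iff by blast
  show thesis
  proof (rule that[of "A \<union> A'" "B \<union> B'"])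
    show "inf y (Inf_fin (insert top (A \<union> A'))) \<le> sup x (Sup_fin (insert bot (B \<union> B')))"
      unfolding Inf_fin_insert_top_Un[OF 1(1) 2(1)] Sup_fin_insert_bot_Un[OF 1(2) 2(2)]
      by (rule order_trans[OF inf_mono[OF order_refl inf_le1]
            order_trans[OF 1(5) sup_mono[OF order_refl sup_ge1]]])
    show "inf y' (Inf_fin (insert top (A \<union> A'))) \<le> sup x' (Sup_fin (insert bot (B \<union> B')))"
      unfolding Inf_fin_insert_top_Un[OF 1(1) 2(1)] Sup_fin_insert_bot_Un[OF 1(2) 2(2)]
      by (rule order_trans[OF inf_mono[OF order_refl inf_le2]
            order_trans[OF 2(5) sup_mono[OF order_refl sup_ge2]]])
  qed (use 1 2 in auto)
qed

lemma quot_leI: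
  assumes "y \<le> x" shows "quot_le J U y x"
  unfolding quot_le_iff
  by (rule exI[of _ "{}"], rule exI[of _ "{}"]) (use assms in simp)

text \<open>Distributivity splits \<open>inf (sup y ?j) ?u\<close> into \<open>inf y ?u\<close> and
  \<open>inf ?j ?u\<close>, and both lie below \<open>sup x ?j\<close>.\<close>

lemma quot_le_trans:
  assumes "quot_le J U z y" "quot_le J U y x"
  shows "quot_le J U z x"
proof -
  obtain A B where AB: "finite A" "finite B" "A \<subseteq> U" "B \<subseteq> J"
    and 1: "inf z (Inf_fin (insert top A)) \<le> sup y (Sup_fin (insert bot B))"
    and 2: "inf y (Inf_fin (insert top A)) \<le> sup x (Sup_fin (insert bot B))"
    using quot_le_common[OF assms] by blast
  let ?u = "Inf_fin (insert top A)" and ?j = "Sup_fin (insert bot B)"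
  have "inf z ?u \<le> inf (sup y ?j) ?u" using 1 by simp
  also have "\<dots> = sup (inf y ?u) (inf ?j ?u)" by (rule inf_sup_distrib2)
  also have "\<dots> \<le> sup x ?j" using 2 by (simp add: le_infI1)
  finally show ?thesis using AB unfolding quot_le_iff by blast
qed

lemma quot_le_inf:
  assumes "quot_le J U y x" "quot_le J U y' x'"
  shows "quot_le J U (inf y y') (inf x x')"
proof -
  obtain A B where AB: "finite A" "finite B" "A \<subseteq> U" "B \<subseteq> J"
    and 1: "inf y (Inf_fin (insert top A)) \<le> sup x (Sup_fin (insert bot B))"
    and 2: "inf y' (Inf_fin (insert top A)) \<le> sup x' (Sup_fin (insert bot B))"
    using quot_le_common[OF assms] by blast
  let ?u = "Inf_fin (insert top A)" and ?j = "Sup_fin (insert bot B)"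
  have "inf (inf y y') ?u \<le> inf (sup x ?j) (sup x' ?j)"
    using inf_mono[OF 1 2] by (simp add: inf_aci)
  also have "\<dots> = sup (inf x x') ?j" by (rule sup_inf_distrib2[symmetric])
  finally show ?thesis using AB unfolding quot_le_iff by blast
qed

lemma quot_le_sup:
  assumes "quot_le J U y x" "quot_le J U y' x'"
  shows "quot_le J U (sup y y') (sup x x')"
proof -
  obtain A B where AB: "finite A" "finite B" "A \<subseteq> U" "B \<subseteq> J"
    and 1: "inf y (Inf_fin (insert top A)) \<le> sup x (Sup_fin (insert bot B))"
    and 2: "inf y' (Inf_fin (insert top A)) \<le> sup x' (Sup_fin (insert bot B))"
    using quot_le_common[OF assms] by blast
  let ?u = "Inf_fin (insert top A)" and ?j = "Sup_fin (insert bot B)"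
  have "inf (sup y y') ?u = sup (inf y ?u) (inf y' ?u)" by (rule inf_sup_distrib2)
  also have "\<dots> \<le> sup (sup x x') ?j"
    using sup_mono[OF 1 2] by (simp add: sup_aci)
  finally show ?thesis using AB unfolding quot_le_iff by blast
qed

text \<open>In the quotient, \<open>y\<close> lies below \<open>inf y (sup a x)\<close>, which
  distributes to the join of \<open>inf y a\<close> and \<open>inf y x\<close>; both are below
  \<open>x\<close>.\<close>

lemma quot_le_cut:
  assumes "quot_le J U (inf a y) x" "quot_le J U y (sup a x)"
  shows "quot_le J U y x"
proof -
  have "quot_le J U y (inf y (sup a x))"
    using quot_le_inf[OF quot_leI[OF order_refl] assms(2), of y] by simp
  moreover have "quot_le J U (inf y (sup a x)) (sup x x)"
    using quot_le_sup[OF assms(1) quot_leI[OF inf_le2], of y x]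
    by (simp add: inf_sup_distrib1 inf_commute)
  ultimately show ?thesis using quot_le_trans by fastforce
qed

lemma quot_le_add_U: "quot_le J (U \<union> {a}) y x \<longleftrightarrow> quot_le J U (inf a y) x"
proof
  assume "quot_le J (U \<union> {a}) y x"
  then obtain A B where AB: "finite A" "finite B" "A \<subseteq> U \<union> {a}" "B \<subseteq> J"
    and le: "inf y (Inf_fin (insert top A)) \<le> sup x (Sup_fin (insert bot B))"
    unfolding quot_le_iff by blast
  \<comment> \<open>Meeting with \<open>a\<close> is harmless even if \<open>a\<close> is not in
    \<open>A\<close>, since it only lowers the left side; this avoids a case split.\<close>
  have "inf a (Inf_fin (insert top (A - {a}))) = Inf_fin (insert a (insert top (A - {a})))"
    using AB by simp
  also have "\<dots> \<le> Inf_fin (insert top A)"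
    by (rule Inf_fin.subset_imp) (use AB in auto)
  finally have "inf y (inf a (Inf_fin (insert top (A - {a})))) \<le> sup x (Sup_fin (insert bot B))"
    by (rule order_trans[OF inf_mono[OF order_refl] le])
  then have "inf (inf a y) (Inf_fin (insert top (A - {a}))) \<le> sup x (Sup_fin (insert bot B))"
    by (simp only: inf_aci)
  then show "quot_le J U (inf a y) x"
    unfolding quot_le_iff using AB by (intro exI[of _ "A - {a}"] exI[of _ B]) auto
next
  assume "quot_le J U (inf a y) x"
  then obtain A B where AB: "finite A" "finite B" "A \<subseteq> U" "B \<subseteq> J"
    and le: "inf (inf a y) (Inf_fin (insert top A)) \<le> sup x (Sup_fin (insert bot B))"
    unfolding quot_le_iff by blast
  have "Inf_fin (insert top (insert a A)) = inf a (Inf_fin (insert top A))"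
    using AB by (simp only: Inf_fin_insert_top_insert)
  then have "inf y (Inf_fin (insert top (insert a A))) \<le> sup x (Sup_fin (insert bot B))"
    using le by (simp only: inf_aci)
  then show "quot_le J (U \<union> {a}) y x"
    unfolding quot_le_iff using AB by (intro exI[of _ "insert a A"] exI[of _ B]) blast
qed

lemma quot_le_add_J: "quot_le (J \<union> {a}) U y x \<longleftrightarrow> quot_le J U y (sup a x)"
proof
  assume "quot_le (J \<union> {a}) U y x"
  then obtain A B where AB: "finite A" "finite B" "A \<subseteq> U" "B \<subseteq> J \<union> {a}"
    and le: "inf y (Inf_fin (insert top A)) \<le> sup x (Sup_fin (insert bot B))"
    unfolding quot_le_iff by blast
  have "Sup_fin (insert bot B) \<le> Sup_fin (insert a (insert bot (B - {a})))"
    by (rule Sup_fin.subset_imp) (use AB in auto)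
  also have "\<dots> = sup a (Sup_fin (insert bot (B - {a})))"
    using AB by simp
  finally have "inf y (Inf_fin (insert top A)) \<le> sup x (sup a (Sup_fin (insert bot (B - {a}))))"
    by (rule order_trans[OF le sup_mono[OF order_refl]])
  then have "inf y (Inf_fin (insert top A)) \<le> sup (sup a x) (Sup_fin (insert bot (B - {a})))"
    by (simp only: sup_aci)
  then show "quot_le J U y (sup a x)"
    unfolding quot_le_iff using AB by (intro exI[of _ A] exI[of _ "B - {a}"]) auto
next
  assume "quot_le J U y (sup a x)"
  then obtain A B where AB: "finite A" "finite B" "A \<subseteq> U" "B \<subseteq> J"
    and le: "inf y (Inf_fin (insert top A)) \<le> sup (sup a x) (Sup_fin (insert bot B))"
    unfolding quot_le_iff by blast
  have "Sup_fin (insert bot (insert a B)) = sup a (Sup_fin (insert bot B))"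
    using AB by (simp only: Sup_fin_insert_bot_insert)
  then have "inf y (Inf_fin (insert top A)) \<le> sup x (Sup_fin (insert bot (insert a B)))"
    using le by (simp only: sup_aci)
  then show "quot_le (J \<union> {a}) U y x"
    unfolding quot_le_iff using AB by (intro exI[of _ A] exI[of _ "insert a B"]) blast
qed

text \<open>Adding \<open>a\<close> to a set that already contains it changes nothing, so the
  adjunction rule reduces the claim to \<open>a \<le> sup a bot\<close>.\<close>

lemma quot_le_bot_if_mem: "a \<in> J \<Longrightarrow> quot_le J U a bot"
  using quot_le_add_J[of J a U a bot] by (simp add: insert_absorb quot_leI)

lemma quot_le_top_if_mem: "a \<in> U \<Longrightarrow> quot_le J U top a"
  using quot_le_add_U[of J U a top a] by (simp add: insert_absorb quot_leI)

section \<open>Membership in conjugate ideals and filters along the quotient order\<close>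

lemma ideal_downward:
  assumes "lattice_ideal I" "x \<in> I" "y \<le> x" shows "y \<in> I"
  using assms unfolding lattice_ideal_def by (metis inf.absorb2)

lemma filter_upward:
  assumes "lattice_filter F" "x \<in> F" "x \<le> y" shows "y \<in> F"
  using assms unfolding lattice_filter_def by (metis sup.absorb2)

lemma Sup_fin_in_ideal:
  assumes "lattice_ideal I" "finite B" "B \<subseteq> I"
  shows "Sup_fin (insert bot B) \<in> I"
  using assms(2,3)
proof (induction B rule: finite_induct)
  case empty then show ?case using assms(1) by (simp add: lattice_ideal_def)
next
  case (insert b B)
  then show ?case using assms(1) by (simp add: Sup_fin_insert_bot_insert lattice_ideal_def del: Sup_fin.insert)
qed

lemma Inf_fin_in_filter:
  assumes "lattice_filter F" "finite A" "A \<subseteq> F"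
  shows "Inf_fin (insert top A) \<in> F"
  using assms(2,3)
proof (induction A rule: finite_induct)
  case empty then show ?case using assms(1) by (simp add: lattice_filter_def)
next
  case (insert a A)
  then show ?case using assms(1) by (simp add: Inf_fin_insert_top_insert lattice_filter_def del: Inf_fin.insert)
qed

text \<open>The right side of the witnessing inequality is in the ideal, hence so is the left side,
  and conjugacy cancels the meet of \<open>A\<close>, which is in the filter.\<close>

lemma ideal_quot_le:
  assumes "lattice_ideal J" "lattice_filter U" "conjugate J U" "quot_le J U y x" "x \<in> J"
  shows "y \<in> J"
proof -
  obtain A B where AB: "finite A" "finite B" "A \<subseteq> U" "B \<subseteq> J"
    and le: "inf y (Inf_fin (insert top A)) \<le> sup x (Sup_fin (insert bot B))"
    using assms(4) unfolding quot_le_iff by blast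
  have "sup x (Sup_fin (insert bot B)) \<in> J"
    using Sup_fin_in_ideal[OF assms(1) AB(2,4)] assms(1,5) unfolding lattice_ideal_def by blast
  then have "inf y (Inf_fin (insert top A)) \<in> J" using le assms(1) ideal_downward by blast
  then show ?thesis
    using assms(3) Inf_fin_in_filter[OF assms(2) AB(1,3)] unfolding conjugate_def by blast
qed

lemma filter_quot_le:
  assumes "lattice_ideal J" "lattice_filter U" "conjugate J U" "quot_le J U y x" "y \<in> U"
  shows "x \<in> U"
proof -
  obtain A B where AB: "finite A" "finite B" "A \<subseteq> U" "B \<subseteq> J"
    and le: "inf y (Inf_fin (insert top A)) \<le> sup x (Sup_fin (insert bot B))"
    using assms(4) unfolding quot_le_iff by blast
  have "inf y (Inf_fin (insert top A)) \<in> U"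
    using Inf_fin_in_filter[OF assms(2) AB(1,3)] assms(2,5) unfolding lattice_filter_def by blast
  then have "sup x (Sup_fin (insert bot B)) \<in> U" using le assms(2) filter_upward by blast
  then show ?thesis
    using assms(3) Sup_fin_in_ideal[OF assms(1) AB(2,4)] unfolding conjugate_def by blast
qed

section \<open>Linked sequences\<close>

text \<open>Only the link at \<open>i\<close> sees the enlarged set, and
  \<open>quot_le_add_U\<close> moves \<open>a\<close> from that set into the link; the same sequence
  works on both sides.\<close>

lemma linkable_add_U:
  assumes "i < length C"
  shows "linkable (add_U C i a) \<longleftrightarrow>
    (\<exists>x. linked_except C i x \<and> link C i (inf a (x (Suc i))) (x i))"
proof -
  have "link (add_U C i a) k y x \<longleftrightarrow> link C k (if k = i then inf a y else y) x"
    if "k < length C" for k x y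
    using that assms by (simp add: link_def add_U_def quot_le_add_U[simplified])
  then have "(\<forall>k<length C. link (add_U C i a) k (x (Suc k)) (x k)) \<longleftrightarrow>
      (\<forall>k<length C. k \<noteq> i \<longrightarrow> link C k (x (Suc k)) (x k)) \<and> link C i (inf a (x (Suc i))) (x i)" for x
    using assms by auto
  moreover have "length (add_U C i a) = length C" by (simp add: add_U_def)
  ultimately show ?thesis by (simp add: linkable_def linked_except_def conj_assoc)
qed

lemma linkable_add_J:
  assumes "i < length C"
  shows "linkable (add_J C i a) \<longleftrightarrow>
    (\<exists>x. linked_except C i x \<and> link C i (x (Suc i)) (sup a (x i)))"
proof -
  have "link (add_J C i a) k y x \<longleftrightarrow> link C k y (if k = i then sup a x else x)"
    if "k < length C" for k x y
    using that assms by (simp add: link_def add_J_def quot_le_add_J[simplified])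
  then have "(\<forall>k<length C. link (add_J C i a) k (x (Suc k)) (x k)) \<longleftrightarrow>
      (\<forall>k<length C. k \<noteq> i \<longrightarrow> link C k (x (Suc k)) (x k)) \<and> link C i (x (Suc i)) (sup a (x i))" for x
    using assms by auto
  moreover have "length (add_J C i a) = length C" by (simp add: add_J_def)
  ultimately show ?thesis by (simp add: linkable_def linked_except_def conj_assoc)
qed

lemma linkable_iff:
  assumes "i < length C"
  shows "linkable C \<longleftrightarrow> (\<exists>x. linked_except C i x \<and> link C i (x (Suc i)) (x i))"
  using assms unfolding linkable_def linked_except_def by auto

lemma link_weaken:
  assumes "link C i y x" "y' \<le> y" "x \<le> x'" shows "link C i y' x'"
  using assms quot_leI quot_le_trans unfolding link_def by metis

text \<open>Meets preserve the links above \<open>i\<close> and joins those below. Only the link at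
  \<open>i\<close> would mix a meet with a join, and it is the missing one.\<close>

lemma linked_except_merge:
  assumes "linked_except C i x" "linked_except C i x'"
  obtains z where "linked_except C i z" "z (Suc i) = inf (x (Suc i)) (x' (Suc i))"
    "z i = sup (x i) (x' i)"
proof
  let ?z = "\<lambda>k. if i < k then inf (x k) (x' k) else sup (x k) (x' k)"
  show "linked_except C i ?z"
    unfolding linked_except_def
  proof (intro conjI allI impI)
    show "?z 0 = bot" using assms by (simp add: linked_except_def)
    show "?z (length C) = top" using assms by (simp add: linked_except_def)
    fix k assume k: "k < length C" "k \<noteq> i"
    then have "link C k (x (Suc k)) (x k)" "link C k (x' (Suc k)) (x' k)"
      using assms by (auto simp: linked_except_def)
    \<comment> \<open>For \<open>k \<noteq> i\<close>, both \<open>k\<close> and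
      \<open>Suc k\<close> fall in the same branch of \<open>?z\<close>.\<close>
    then show "link C k (?z (Suc k)) (?z k)"
      using k by (auto simp: link_def quot_le_inf quot_le_sup)
  qed
qed auto

text \<open>A jump from \<open>bot\<close> to \<open>top\<close> just after \<open>i\<close> makes
  every other link trivial. It is the witness for single elements.\<close>

lemma linked_except_step:
  assumes "i < length C"
  obtains x :: "nat \<Rightarrow> 'a::{bounded_lattice,distrib_lattice}"
  where "linked_except C i x" "x (Suc i) = top" "x i = bot"
proof
  let ?x = "\<lambda>k. if i < k then top else bot :: 'a"
  show "linked_except C i ?x"
    using assms by (auto simp: linked_except_def link_def intro: quot_leI)
qed auto

lemma linkable_cut:
  assumes "i < length C" "linkable (add_J C i a)" "linkable (add_U C i a)"
  shows "linkable C"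
proof -
  obtain x where x: "linked_except C i x" "link C i (inf a (x (Suc i))) (x i)"
    using assms linkable_add_U by blast
  obtain x' where x': "linked_except C i x'" "link C i (x' (Suc i)) (sup a (x' i))"
    using assms linkable_add_J by blast
  obtain z where z: "linked_except C i z" "z (Suc i) = inf (x (Suc i)) (x' (Suc i))"
    "z i = sup (x i) (x' i)"
    using linked_except_merge x x' by blast
  \<comment> \<open>Passing to \<open>z\<close> lowers the left and raises the right side of the
    link at \<open>i\<close>, so both conditions on \<open>a\<close> hold for one sequence.\<close>
  have "link C i (inf a (z (Suc i))) (z i)"
    using link_weaken[OF x(2)] z(2,3) by (simp add: le_infI2)
  moreover have "link C i (z (Suc i)) (sup a (z i))"
    using link_weaken[OF x'(2)] z(2,3) by (simp add: le_supI2)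
  ultimately have "link C i (z (Suc i)) (z i)"
    unfolding link_def by (rule quot_le_cut)
  then show ?thesis using z(1) assms(1) linkable_iff by blast
qed

lemma linkable_extend:
  assumes "i < length C" "linkable C"
  shows "linkable (add_U C i a)" "linkable (add_J C i a)"
proof -
  obtain x where x: "linked_except C i x" "link C i (x (Suc i)) (x i)"
    using assms linkable_iff by blast
  show "linkable (add_U C i a)"
    using x link_weaken[OF x(2) inf_le2 order_refl] assms linkable_add_U by blast
  show "linkable (add_J C i a)"
    using x link_weaken[OF x(2) order_refl sup_ge2] assms linkable_add_J by blast
qed

section \<open>Linked sequences inside saturated refinements\<close>

text \<open>Membership spreads from both ends towards the gap: from \<open>bot\<close> through the
  increasing ideals up to \<open>i\<close>, and from \<open>top\<close> through the increasing
  filters down to \<open>i\<close>.\<close>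

lemma saturated_linked_except:
  assumes E: "saturated E" "refinement E C" and x: "linked_except C i x" and i: "i < length C"
  shows "x i \<in> chain_J E i" "x (Suc i) \<in> chain_U E i"
proof -
  have len: "length E = length C" using E(2) by (simp add: refinement_def)
  have sat: "lattice_ideal (chain_J E k)" "lattice_filter (chain_U E k)"
    "conjugate (chain_J E k) (chain_U E k)" if "k < length C" for k
    using E(1) len that by (auto simp: saturated_def)
  have link: "quot_le (chain_J E k) (chain_U E k) (x (Suc k)) (x k)"
    if "k < length C" "k \<noteq> i" for k
  proof -
    have "chain_J C k \<subseteq> chain_J E k" "chain_U C k \<subseteq> chain_U E k"
      using E(2) that by (auto simp: refinement_def)
    then show ?thesis
      using x that unfolding linked_except_def link_def quot_le_def by (meson subset_trans)
  qed
  have "k \<le> i \<Longrightarrow> x k \<in> chain_J E k" for k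
  proof (induction k)
    case 0
    have "0 < length C" using i by linarith
    then show ?case
      using x sat(1) unfolding linked_except_def lattice_ideal_def by metis
  next
    case (Suc k)
    then have "x (Suc k) \<in> chain_J E k"
      using ideal_quot_le[OF sat[of k] link[of k]] i by auto
    moreover have "chain_J E k \<subseteq> chain_J E (Suc k)"
      using E(1) Suc.prems i len by (simp add: saturated_def)
    ultimately show ?case by blast
  qed
  then show "x i \<in> chain_J E i" by simp
  \<comment> \<open>Here \<open>n\<close> is the last index; the induction descends from it to
    \<open>i\<close> and uses only links at indices \<open>Suc k\<close> above the gap.\<close>
  obtain n where n: "length C = Suc n" using i by (cases "length C") auto
  have "i \<le> n" using i n by simp
  then show "x (Suc i) \<in> chain_U E i"
  proof (induction rule: inc_induct)
    case base
    then show ?case using x sat(2)[of n] n by (auto simp: linked_except_def lattice_filter_def)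
  next
    case (step k)
    then have "x (Suc k) \<in> chain_U E (Suc k)"
      using filter_quot_le[OF sat[of "Suc k"] link[of "Suc k"]] n by auto
    moreover have "chain_U E (Suc k) \<subseteq> chain_U E k"
      using E(1) step.hyps n len by (simp add: saturated_def)
    ultimately show ?case by blast
  qed
qed

text \<open>The ends of the gap lie in the ideal and the filter at \<open>i\<close>, so the link
  puts \<open>inf a (x (Suc i))\<close> in the ideal (dually \<open>sup a (x i)\<close> in the
  filter), and conjugacy extracts \<open>a\<close>. This gives minimality of the saturation.\<close>

lemma saturated_linkable:
  assumes E: "saturated E" "refinement E C" and i: "i < length C"
  shows "linkable (add_U C i a) \<Longrightarrow> a \<in> chain_J E i"
    and "linkable (add_J C i a) \<Longrightarrow> a \<in> chain_U E i"
proof -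
  have sat: "lattice_ideal (chain_J E i)" "lattice_filter (chain_U E i)"
    "conjugate (chain_J E i) (chain_U E i)"
    using E i by (auto simp: saturated_def refinement_def)
  have mono: "quot_le (chain_J E i) (chain_U E i) y x" if "link C i y x" for x y
  proof -
    have "chain_J C i \<subseteq> chain_J E i" "chain_U C i \<subseteq> chain_U E i"
      using E(2) i by (auto simp: refinement_def)
    then show ?thesis
      using that unfolding link_def quot_le_def by (meson subset_trans)
  qed
  show "a \<in> chain_J E i" if lk: "linkable (add_U C i a)"
  proof -
    obtain x where x: "linked_except C i x" "link C i (inf a (x (Suc i))) (x i)"
      using lk linkable_add_U i by blast
    note xE = saturated_linked_except[OF E x(1) i]
    have "inf a (x (Suc i)) \<in> chain_J E i"
      using ideal_quot_le[OF sat mono[OF x(2)] xE(1)] .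
    then show ?thesis using sat(3) xE(2) unfolding conjugate_def by blast
  qed
  show "a \<in> chain_U E i" if lk: "linkable (add_J C i a)"
  proof -
    obtain x where x: "linked_except C i x" "link C i (x (Suc i)) (sup a (x i))"
      using lk linkable_add_J i by blast
    note xE = saturated_linked_except[OF E x(1) i]
    have "sup a (x i) \<in> chain_U E i"
      using filter_quot_le[OF sat mono[OF x(2)] xE(2)] .
    then show ?thesis using sat(3) xE(1) unfolding conjugate_def by blast
  qed
qed

section \<open>The saturation of a chain\<close>

text \<open>This is \<open>collapse_extension\<close> with linkability in place of collapse; the
  original sets are contained in it by \<open>linkable_if_mem\<close>.\<close>

definition saturation :: "'a::{bounded_lattice,distrib_lattice} ichain \<Rightarrow> 'a ichain" where
  "saturation C =
     map (\<lambda>i. ({a. linkable (add_U C i a)}, {a. linkable (add_J C i a)})) [0..<length C]"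

text \<open>Reduces closure properties that combine two elements, each with its own sequence, to a
  single link between the merged ends of the gap.\<close>

lemma linkable_merge2:
  assumes i: "i < length C" and "linked_except C i x" "linked_except C i x'"
  shows "link C i (inf a (inf (x (Suc i)) (x' (Suc i)))) (sup (x i) (x' i)) \<Longrightarrow>
      linkable (add_U C i a)"
    and "link C i (inf (x (Suc i)) (x' (Suc i))) (sup a (sup (x i) (x' i))) \<Longrightarrow>
      linkable (add_J C i a)"
proof -
  obtain z where z: "linked_except C i z" "z (Suc i) = inf (x (Suc i)) (x' (Suc i))"
    "z i = sup (x i) (x' i)"
    using linked_except_merge assms(2,3) by blast
  show "linkable (add_U C i a)"
    if "link C i (inf a (inf (x (Suc i)) (x' (Suc i)))) (sup (x i) (x' i))"
    using that z linkable_add_U[OF i] by auto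
  show "linkable (add_J C i a)"
    if "link C i (inf (x (Suc i)) (x' (Suc i))) (sup a (sup (x i) (x' i)))"
    using that z linkable_add_J[OF i] by auto
qed

lemma lattice_ideal_linkable:
  assumes i: "i < length C"
  shows "lattice_ideal {a. linkable (add_U C i a)}"
  unfolding lattice_ideal_def
proof (intro conjI ballI allI; clarsimp)
  obtain x where "linked_except C i x" "x (Suc i) = top" "x i = bot"
    using linked_except_step[OF i] .
  then show "linkable (add_U C i bot)"
    unfolding linkable_add_U[OF i] by (auto simp: link_def quot_leI)
next
  fix a b assume "linkable (add_U C i a)" "linkable (add_U C i b)"
  then obtain x x' where x: "linked_except C i x" "link C i (inf a (x (Suc i))) (x i)"
    and x': "linked_except C i x'" "link C i (inf b (x' (Suc i))) (x' i)"
    using linkable_add_U[OF i] by blast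
  show "linkable (add_U C i (sup a b))"
  proof (rule linkable_merge2(1)[OF i x(1) x'(1)])
    have "link C i (sup (inf a (x (Suc i))) (inf b (x' (Suc i)))) (sup (x i) (x' i))"
      using x(2) x'(2) unfolding link_def by (rule quot_le_sup)
    \<comment> \<open>After distribution, each of the two parts forgets the end of the other
      sequence.\<close>
    moreover have "inf (sup a b) (inf (x (Suc i)) (x' (Suc i)))
        \<le> sup (inf a (x (Suc i))) (inf b (x' (Suc i)))"
      unfolding inf_sup_distrib2 by (intro sup_mono inf_mono) auto
    ultimately show "link C i (inf (sup a b) (inf (x (Suc i)) (x' (Suc i)))) (sup (x i) (x' i))"
      using link_weaken by blast
  qed
next
  fix a b assume "linkable (add_U C i a)"
  then obtain x where x: "linked_except C i x" "link C i (inf a (x (Suc i))) (x i)"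
    using linkable_add_U[OF i] by blast
  have "link C i (inf (inf a b) (x (Suc i))) (x i)"
    by (rule link_weaken[OF x(2)]) (auto intro: le_infI1 le_infI2)
  then show "linkable (add_U C i (inf a b))"
    using x(1) linkable_add_U[OF i] by blast
qed

lemma lattice_filter_linkable:
  assumes i: "i < length C"
  shows "lattice_filter {a. linkable (add_J C i a)}"
  unfolding lattice_filter_def
proof (intro conjI ballI allI; clarsimp)
  obtain x where "linked_except C i x" "x (Suc i) = top" "x i = bot"
    using linked_except_step[OF i] .
  then show "linkable (add_J C i top)"
    unfolding linkable_add_J[OF i] by (auto simp: link_def quot_leI)
next
  fix a b assume "linkable (add_J C i a)" "linkable (add_J C i b)"
  then obtain x x' where x: "linked_except C i x" "link C i (x (Suc i)) (sup a (x i))"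
    and x': "linked_except C i x'" "link C i (x' (Suc i)) (sup b (x' i))"
    using linkable_add_J[OF i] by blast
  show "linkable (add_J C i (inf a b))"
  proof (rule linkable_merge2(2)[OF i x(1) x'(1)])
    have "link C i (inf (x (Suc i)) (x' (Suc i))) (inf (sup a (x i)) (sup b (x' i)))"
      using x(2) x'(2) unfolding link_def by (rule quot_le_inf)
    moreover have "inf (sup a (x i)) (sup b (x' i)) \<le> sup (inf a b) (sup (x i) (x' i))"
      unfolding sup_inf_distrib2 by (intro sup_mono inf_mono) auto
    ultimately show "link C i (inf (x (Suc i)) (x' (Suc i))) (sup (inf a b) (sup (x i) (x' i)))"
      using link_weaken by blast
  qed
next
  fix a b assume "linkable (add_J C i a)"
  then obtain x where x: "linked_except C i x" "link C i (x (Suc i)) (sup a (x i))"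
    using linkable_add_J[OF i] by blast
  have "link C i (x (Suc i)) (sup (sup a b) (x i))"
    by (rule link_weaken[OF x(2)]) (auto intro: le_supI1 le_supI2)
  then show "linkable (add_J C i (sup a b))"
    using x(1) linkable_add_J[OF i] by blast
qed

text \<open>Conjugacy is the quotient cut on merged sequences: the two hypotheses put
  \<open>f\<close> (dually \<open>j\<close>) on opposite sides of a link, and cutting it leaves the
  link for \<open>a\<close>.\<close>

lemma conjugate_linkable:
  assumes i: "i < length C"
  shows "conjugate {a. linkable (add_U C i a)} {a. linkable (add_J C i a)}"
  unfolding conjugate_def
proof (intro conjI ballI allI impI; clarsimp)
  fix a f assume "linkable (add_J C i f)" "linkable (add_U C i (inf a f))"
  then obtain x x' where x: "linked_except C i x" "link C i (x (Suc i)) (sup f (x i))"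
    and x': "linked_except C i x'" "link C i (inf (inf a f) (x' (Suc i))) (x' i)"
    using linkable_add_J[OF i] linkable_add_U[OF i] by blast
  show "linkable (add_U C i a)"
  proof (rule linkable_merge2(1)[OF i x(1) x'(1)], unfold link_def, rule quot_le_cut[where a = f],
      fold link_def)
    show "link C i (inf f (inf a (inf (x (Suc i)) (x' (Suc i))))) (sup (x i) (x' i))"
      by (rule link_weaken[OF x'(2)]) (auto intro: le_infI1 le_infI2)
    show "link C i (inf a (inf (x (Suc i)) (x' (Suc i)))) (sup f (sup (x i) (x' i)))"
      by (rule link_weaken[OF x(2)]) (auto intro: le_infI1 le_infI2 le_supI1 le_supI2)
  qed
next
  fix a j assume "linkable (add_U C i j)" "linkable (add_J C i (sup a j))"
  then obtain x x' where x: "linked_except C i x" "link C i (inf j (x (Suc i))) (x i)"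
    and x': "linked_except C i x'" "link C i (x' (Suc i)) (sup (sup a j) (x' i))"
    using linkable_add_J[OF i] linkable_add_U[OF i] by blast
  show "linkable (add_J C i a)"
  proof (rule linkable_merge2(2)[OF i x(1) x'(1)], unfold link_def, rule quot_le_cut[where a = j],
      fold link_def)
    show "link C i (inf j (inf (x (Suc i)) (x' (Suc i)))) (sup a (sup (x i) (x' i)))"
      by (rule link_weaken[OF x(2)]) (auto intro: le_infI1 le_infI2 le_supI1 le_supI2)
    show "link C i (inf (x (Suc i)) (x' (Suc i))) (sup j (sup a (sup (x i) (x' i))))"
      by (rule link_weaken[OF x'(2)]) (auto intro: le_infI1 le_infI2 le_supI1 le_supI2)
  qed
qed

text \<open>
  The missing link moves from \<open>i\<close> to \<open>i + 1\<close> when \<open>x\<^bsub>i+1\<^esub>\<close> is replaced by \<open>a \<sqinter> x\<^bsub>i+1\<^esub>\<close>.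
\<close>

lemma linkable_add_U_Suc:
  assumes i: "Suc i < length C" and "linkable (add_U C i a)"
  shows "linkable (add_U C (Suc i) a)"
proof -
  obtain x where x: "linked_except C i x" "link C i (inf a (x (Suc i))) (x i)"
    using assms linkable_add_U[of i C a] by auto
  let ?z = "x(Suc i := inf a (x (Suc i)))"
  \<comment> \<open>At \<open>i\<close> the changed value turns the given relation on
    \<open>inf a (x (Suc i))\<close> into an ordinary link.\<close>
  have "linked_except C (Suc i) ?z"
    using x i by (auto simp: linked_except_def)
  moreover have "link C (Suc i) (x (Suc (Suc i))) (x (Suc i))"
    using x i by (auto simp: linked_except_def)
  then have "link C (Suc i) (inf a (?z (Suc (Suc i)))) (?z (Suc i))"
    using quot_le_inf[OF quot_leI[OF order_refl]] by (simp add: link_def)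
  ultimately show ?thesis using linkable_add_U[OF i] by blast
qed

text \<open>Dually, replacing \<open>x (Suc i)\<close> by \<open>sup a (x (Suc i))\<close> moves the
  gap from \<open>Suc i\<close> down to \<open>i\<close>.\<close>

lemma linkable_add_J_Suc:
  assumes i: "Suc i < length C" and "linkable (add_J C (Suc i) a)"
  shows "linkable (add_J C i a)"
proof -
  obtain x where x: "linked_except C (Suc i) x"
    "link C (Suc i) (x (Suc (Suc i))) (sup a (x (Suc i)))"
    using assms linkable_add_J[of "Suc i" C a] by auto
  let ?z = "x(Suc i := sup a (x (Suc i)))"
  have "linked_except C i ?z"
    using x i by (auto simp: linked_except_def)
  moreover have "link C i (x (Suc i)) (x i)"
    using x i by (auto simp: linked_except_def)
  then have "link C i (?z (Suc i)) (sup a (?z i))"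
    using quot_le_sup[OF quot_leI[OF order_refl]] by (simp add: link_def)
  ultimately show ?thesis using linkable_add_J[of i C a] i by auto
qed

lemma saturated_saturation: "saturated (saturation C)"
  by (auto simp: saturated_def saturation_def lattice_ideal_linkable lattice_filter_linkable
      conjugate_linkable linkable_add_U_Suc linkable_add_J_Suc)

text \<open>For the step sequence, the link at \<open>i\<close> reduces to \<open>a\<close> below
  \<open>bot\<close>, respectively \<open>top\<close> below \<open>a\<close>, in the
  quotient.\<close>

lemma linkable_if_mem:
  assumes i: "i < length C"
  shows "a \<in> chain_J C i \<Longrightarrow> linkable (add_U C i a)"
    and "a \<in> chain_U C i \<Longrightarrow> linkable (add_J C i a)"
proof -
  obtain x where x: "linked_except C i x" "x (Suc i) = top" "x i = bot"
    using linked_except_step[OF i] .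
  show "linkable (add_U C i a)" if "a \<in> chain_J C i"
    using that x unfolding linkable_add_U[OF i] link_def
    by (intro exI[of _ x]) (simp add: quot_le_bot_if_mem)
  show "linkable (add_J C i a)" if "a \<in> chain_U C i"
    using that x unfolding linkable_add_J[OF i] link_def
    by (intro exI[of _ x]) (simp add: quot_le_top_if_mem)
qed

lemma refinement_saturation: "refinement (saturation C) C"
  by (auto simp: refinement_def saturation_def linkable_if_mem)

lemma least_saturation: "least_saturated_refinement (saturation C) C"
  unfolding least_saturated_refinement_def
proof (intro conjI allI impI saturated_saturation refinement_saturation)
  fix E assume "saturated E \<and> refinement E C"
  then show "refinement E (saturation C)"
    using saturated_linkable[of E C]
    by (auto simp: refinement_def saturation_def)
qed

section \<open>Collapse\<close>

lemma saturated_replicate_UNIV: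
  "saturated (replicate n (UNIV, UNIV))"
  by (auto simp: saturated_def lattice_ideal_def lattice_filter_def conjugate_def)

text \<open>If \<open>C\<close> collapses, its saturation is trivial, so one element can be added on
  either side and cut away. Conversely, a linked sequence survives every addition, which forces
  every element into every saturated refinement.\<close>

lemma collapses_iff_linkable:
  assumes "C \<noteq> []"
  shows "collapses C \<longleftrightarrow> linkable C"
proof
  assume "collapses C"
  then have eq: "saturation C = replicate (length C) (UNIV, UNIV)"
    using saturated_saturation refinement_saturation unfolding collapses_def by blast
  have 0: "0 < length C" using assms by simp
  have "saturation C ! 0 = (UNIV, UNIV)" using eq 0 by simp
  \<comment> \<open>The element \<open>bot\<close> is an arbitrary choice; index 0 exists because
    \<open>C\<close> is nonempty.\<close>
  then have "linkable (add_J C 0 bot)" "linkable (add_U C 0 bot)"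
    using 0 by (auto simp: saturation_def)
  then show "linkable C" using linkable_cut[OF 0] by blast
next
  assume C: "linkable C"
  have "E = replicate (length C) (UNIV, UNIV)" if E: "saturated E" "refinement E C" for E
  proof (rule nth_equalityI)
    show len: "length E = length (replicate (length C) (UNIV, UNIV))"
      using E(2) by (simp add: refinement_def)
    fix i assume "i < length E"
    then have i: "i < length C" using len by simp
    have "chain_J E i = UNIV" "chain_U E i = UNIV"
      using saturated_linkable[OF E i] linkable_extend[OF i C] by auto
    then show "E ! i = replicate (length C) (UNIV, UNIV) ! i"
      using i by (simp add: prod_eq_iff)
  qed
  \<comment> \<open>Collapse also asks that the trivial chain itself be a saturated
    refinement.\<close>
  moreover have "refinement (replicate (length C) (UNIV, UNIV)) C"
    by (simp add: refinement_def)
  ultimately show "collapses C"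
    unfolding collapses_def using saturated_replicate_UNIV by blast
qed

lemma collapse_extension_eq_saturation: "collapse_extension C = saturation C"
proof (rule nth_equalityI)
  fix i assume "i < length (collapse_extension C)"
  then have i: "i < length C" by (simp add: collapse_extension_def)
  then have "add_U C i a \<noteq> []" "add_J C i a \<noteq> []" for a
    by (auto simp: add_U_def add_J_def)
  then show "collapse_extension C ! i = saturation C ! i"
    using i by (auto simp: collapse_extension_def saturation_def collapses_iff_linkable
        linkable_if_mem)
qed (simp add: collapse_extension_def saturation_def)

section \<open>From linked sequences to the displayed relations\<close>

lemma linkable_iff_finite_chain:
  assumes "idealistic_chain l C"
  shows "linkable C \<longleftrightarrow>
    (\<exists>(x :: nat \<Rightarrow> 'a::{bounded_lattice,distrib_lattice}) C'.
       idealistic_chain l C' \<and> finite_chain C' \<and> refinement C C' \<and>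
       (\<forall>i\<le>l. (if i < l then {x (Suc i)} else {}) \<union> chain_U C' i
                \<turnstile> chain_J C' i \<union> (if 0 < i then {x i} else {})))" (is "_ \<longleftrightarrow> ?R")
proof -
  have len: "length C = Suc l" using assms by (simp add: idealistic_chain_def)
  \<comment> \<open>The first and last relations lack a term. Overwriting \<open>x\<close> by
    \<open>bot\<close> at 0 and \<open>top\<close> at \<open>Suc l\<close> fills both places without
    effect on the entailments, so all rows take the form of a link.\<close>
  have row: "(if i < l then {x (Suc i)} else {}) \<union> A \<turnstile> B \<union> (if 0 < i then {x i} else {})
      \<longleftrightarrow> insert ((x(0 := bot, Suc l := top)) (Suc i)) A \<turnstile> insert ((x(0 := bot, Suc l := top)) i) B"
    if "i \<le> l" "finite A" "finite B" for i A B and x :: "nat \<Rightarrow> 'a"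
    using that by (auto simp: entails_insert_bot entails_insert_top)
  show ?thesis
  proof
    assume "linkable C"
    then obtain x where x: "x 0 = bot" "x (Suc l) = top"
      and "\<forall>k\<le>l. link C k (x (Suc k)) (x k)"
      using len by (auto simp: linkable_def less_Suc_eq_le)
    then obtain A B where AB: "\<And>k. k \<le> l \<Longrightarrow> finite (A k) \<and> finite (B k) \<and>
        A k \<subseteq> chain_U C k \<and> B k \<subseteq> chain_J C k \<and> insert (x (Suc k)) (A k) \<turnstile> insert (x k) (B k)"
      unfolding link_def quot_le_def by metis
    let ?C' = "map (\<lambda>k. (B k, A k)) [0..<Suc l]"
    have nth: "?C' ! k = (B k, A k)" if "k \<le> l" for k
      using that by (simp del: upt_Suc)
    \<comment> \<open>A linked sequence already has the end values, so \<open>row\<close> applies to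
      \<open>x\<close> itself.\<close>
    have upd: "x(0 := bot, Suc l := top) = x" using x by auto
    show ?R
    proof (intro exI[of _ x] exI[of _ ?C'] conjI allI impI)
      show "finite_chain ?C'"
        using AB nth by (simp add: finite_chain_def less_Suc_eq_le del: upt_Suc)
      show "refinement C ?C'"
        using AB nth len by (simp add: refinement_def less_Suc_eq_le del: upt_Suc)
      fix i assume "i \<le> l"
      then show "(if i < l then {x (Suc i)} else {}) \<union> chain_U ?C' i
          \<turnstile> chain_J ?C' i \<union> (if 0 < i then {x i} else {})"
        using row[of i "A i" "B i" x] AB nth unfolding upd by simp
    qed (simp add: idealistic_chain_def)
  next
    assume ?R
    then obtain x C' where C': "idealistic_chain l C'" "finite_chain C'" "refinement C C'"
      and rows: "\<And>i. i \<le> l \<Longrightarrow> (if i < l then {x (Suc i)} else {}) \<union> chain_U C' i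
                \<turnstile> chain_J C' i \<union> (if 0 < i then {x i} else {})"
      by blast
    \<comment> \<open>The given \<open>x\<close> is unconstrained at 0 and \<open>Suc l\<close>, so
      the end values are imposed here.\<close>
    let ?x = "x(0 := bot, Suc l := top)"
    have "link C k (?x (Suc k)) (?x k)" if k: "k \<le> l" for k
    proof -
      have fin: "finite (chain_U C' k)" "finite (chain_J C' k)"
        "chain_U C' k \<subseteq> chain_U C k" "chain_J C' k \<subseteq> chain_J C k"
        using C' k by (auto simp: idealistic_chain_def finite_chain_def refinement_def less_Suc_eq_le)
      then show ?thesis
        using rows[OF k] row[OF k fin(1,2), of x] unfolding link_def quot_le_def by blast
    qed
    then show "linkable C"
      unfolding linkable_def len
      by (intro exI[of _ ?x] conjI allI impI) (simp_all only: less_Suc_eq_le, simp_all)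
  qed
qed

theorem theorem2p14:
  fixes C :: "'a::{bounded_lattice,distrib_lattice} ichain" and l :: nat
  assumes "idealistic_chain l C"
  shows "(collapses C \<longleftrightarrow>
            (\<exists>(x :: nat \<Rightarrow> 'a) C'. idealistic_chain l C' \<and> finite_chain C' \<and> refinement C C' \<and>
               (\<forall>i\<le>l. (if i < l then {x (Suc i)} else {}) \<union> chain_U C' i
                        \<turnstile> chain_J C' i \<union> (if 0 < i then {x i} else {}))))
       \<and> least_saturated_refinement (collapse_extension C) C
       \<and> (\<forall>x. \<forall>i\<le>l. collapses (add_J C i x) \<and> collapses (add_U C i x) \<longrightarrow> collapses C)"
proof (intro conjI allI impI)
  have len: "length C = Suc l" using assms by (simp add: idealistic_chain_def)
  then have ne: "C \<noteq> []" by auto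
  show "collapses C \<longleftrightarrow>
      (\<exists>(x :: nat \<Rightarrow> 'a) C'. idealistic_chain l C' \<and> finite_chain C' \<and> refinement C C' \<and>
         (\<forall>i\<le>l. (if i < l then {x (Suc i)} else {}) \<union> chain_U C' i
                  \<turnstile> chain_J C' i \<union> (if 0 < i then {x i} else {})))"
    using collapses_iff_linkable[OF ne] linkable_iff_finite_chain[OF assms] by simp
  show "least_saturated_refinement (collapse_extension C) C"
    unfolding collapse_extension_eq_saturation by (rule least_saturation)
  fix x i assume i: "i \<le> l" and col: "collapses (add_J C i x) \<and> collapses (add_U C i x)"
  have "add_J C i x \<noteq> []" "add_U C i x \<noteq> []"
    using ne by (simp_all add: add_J_def add_U_def)
  then show "collapses C"
    using col linkable_cut[of i C x] i len ne by (simp add: collapses_iff_linkable)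
qed

end
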